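(* Let $d, M \ge 1$, let $r_1,\dots,r_M \in \mathbf{R}^d$, $R=(r_1,\dots,r_M)$, let $y \in \mathbf{R}^M$, and let $\theta(x;R) = (\|x-r_1\|,\dots,\|x-r_M\|) \in \mathbf{R}^M$ for $x \in \mathbf{R}^d$. Let $\Phi \subseteq \mathbf{R}^M$ be a closed, convex set with non-empty interior, and let $$\mathcal{X} = \{ x \in \mathbf{R}^d : y-\theta(x;R) \in \Phi,\ \theta(x;R)+\Phi \subseteq \mathbf{R}_+^M \},$$ which is assumed to be non-empty. Let $\mathcal{F}$ be the set of all densities $f_\Delta \in \mathcal{D}_M$ such that (i) $f_\Delta(\delta)=0$ for every $\delta \notin \Phi$; (ii) $S_\Delta = \Phi$, where $S_\Delta$ is the support of a random vector $\Delta$ in $\mathbf{R}^M$ with density $f_\Delta$; (iii) there exists $x^* \in \mathbf{R}^d$ with $f_\Delta(y-\theta(x^*;R))>0$ and $\theta(x^*;R)+\Phi \subseteq \mathbf{R}_+^M$. For $f_\Delta \in \mathcal{F}$, let $A(f_\Delta)$ be the set of maximizers of $x \mapsto f_\Delta(y-\theta(x;R))$ over the feasible set $\{x \in \mathbf{R}^d : \theta(x;R)+\Phi \subseteq \mathbf{R}_+^M\}$. Then $$\bigcup_{f_\Delta \in \mathcal{F}} A(f_\Delta) = \mathcal{X}.$$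
   Context: $\|\cdot\|$ is the Euclidean norm. $\mathbf{R}_+^M$ is the set of vectors in $\mathbf{R}^M$ with all components nonnegative. For $a \in \mathbf{R}^M$ and $\Phi \subseteq \mathbf{R}^M$, $a+\Phi = \{a+\phi : \phi \in \Phi\}$. $\mathcal{D}_M$ is the set of probability densities (with respect to Lebesgue measure) on $\mathbf{R}^M$, regarded as pointwise-defined functions: $\mathcal{D}_M = \{ f : \int_{\mathbf{R}^M} f(t)\,dt = 1,\ f(t) \ge 0 \ \forall t \in \mathbf{R}^M\}$. The support $S_\Delta$ of a random vector $\Delta$ in $\mathbf{R}^M$ is the minimal closed set that supports $\Delta$: it is the closed set such that, for every closed set $C \subseteq \mathbf{R}^M$, $\mathbb{P}(\Delta \in C)=1$ if and only if $S_\Delta \subseteq C$. The set of maximizers of a function over a feasible set is the set of feasible points at which the function attains its maximum over the feasible set (empty if the maximum is not attained). *)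

theory Defs
  imports "HOL-Analysis.Analysis"
begin

definition theta :: "(real^'d)^'m \<Rightarrow> real^'d \<Rightarrow> real^'m" where
  "theta R x = (\<chi> i. norm (x - R $ i))"

definition nonneg_orthant :: "(real^'m) set" where
  "nonneg_orthant = {v. \<forall>i. 0 \<le> v $ i}"

definition feasible :: "(real^'m) set \<Rightarrow> (real^'d)^'m \<Rightarrow> (real^'d) set" where
  "feasible \<Phi> R = {x. (\<lambda>\<phi>. theta R x + \<phi>) ` \<Phi> \<subseteq> nonneg_orthant}"

definition solution_set ::
  "(real^'m) set \<Rightarrow> (real^'d)^'m \<Rightarrow> real^'m \<Rightarrow> (real^'d) set" where
  "solution_set \<Phi> R y =
     {x. y - theta R x \<in> \<Phi> \<and> (\<lambda>\<phi>. theta R x + \<phi>) ` \<Phi> \<subseteq> nonneg_orthant}"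

text \<open>Densities are pointwise-defined functions (not classes modulo null sets) and are only
  required to be Lebesgue measurable, hence the use of \<^term>\<open>lebesgue\<close>, not \<^term>\<open>lborel\<close>.\<close>

definition prob_densities :: "(real^'m \<Rightarrow> real) set" where
  "prob_densities =
     {f. integrable lebesgue f \<and> integral\<^sup>L lebesgue f = 1 \<and> (\<forall>t. 0 \<le> f t)}"

text \<open>The law of a random vector with density \<open>f\<close>: the probability that the vector lies in
  \<open>C\<close> is \<open>measure (law_of_density f) C\<close>.\<close>

definition law_of_density :: "(real^'m \<Rightarrow> real) \<Rightarrow> (real^'m) measure" where
  "law_of_density f = density lebesgue (\<lambda>t. ennreal (f t))"

text \<open>\<open>is_support \<mu> S\<close> says that \<open>S\<close> is the support of a random vector with law \<open>\<mu>\<close>. The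
  support depends on the vector only through its law, and there is at most one such \<open>S\<close>.\<close>

definition is_support :: "(real^'m) measure \<Rightarrow> (real^'m) set \<Rightarrow> bool" where
  "is_support \<mu> S \<longleftrightarrow>
     closed S \<and> (\<forall>C. closed C \<longrightarrow> (measure \<mu> C = 1 \<longleftrightarrow> S \<subseteq> C))"

lemma is_support_unique:
  assumes "is_support \<mu> S" and "is_support \<mu> T"
  shows "S = T"
  using assms unfolding is_support_def by blast

definition admissible_densities ::
  "(real^'m) set \<Rightarrow> (real^'d)^'m \<Rightarrow> real^'m \<Rightarrow> (real^'m \<Rightarrow> real) set" where
  "admissible_densities \<Phi> R y =
     {f \<in> prob_densities.
        (\<forall>\<delta>. \<delta> \<notin> \<Phi> \<longrightarrow> f \<delta> = 0) \<and>
        is_support (law_of_density f) \<Phi> \<and>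
        (\<exists>x. f (y - theta R x) > 0 \<and>
             (\<lambda>\<phi>. theta R x + \<phi>) ` \<Phi> \<subseteq> nonneg_orthant)}"

definition ml_estimates ::
  "(real^'m) set \<Rightarrow> (real^'d)^'m \<Rightarrow> real^'m \<Rightarrow> (real^'m \<Rightarrow> real) \<Rightarrow> (real^'d) set" where
  "ml_estimates \<Phi> R y f =
     {x. is_arg_max (\<lambda>x. f (y - theta R x)) (\<lambda>x. x \<in> feasible \<Phi> R) x}"

end

theory Submission
  imports Defs "HOL-Probability.Probability_Measure"
begin

text \<open>
  Every maximizer lies in the solution set because an admissible density is positive at some
  feasible residual and vanishes off \<open>\<Phi>\<close>: the maximal value is then positive, so it is attained
  at a residual in \<open>\<Phi>\<close>.

  Conversely, a point \<open>x\<close> of the solution set is a maximizer for a density that has its global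
  maximum at the residual \<open>t = y - theta R x \<in> \<Phi>\<close>, and such a density that is moreover positive
  exactly on \<open>\<Phi>\<close> exists (\<open>exists_density_positive_on_peaked_at\<close>). Densities are
  pointwise-defined functions, so the peak at \<open>t\<close> can be put in by hand, on a null set.
  The support condition is automatic (\<open>is_support_density_positive_on_convex\<close>): a density
  that is positive exactly on \<open>\<Phi>\<close> gives full mass to a closed set \<open>C\<close> iff \<open>\<Phi> - C\<close> is negligible,
  and for a closed convex \<open>\<Phi>\<close> with interior this means \<open>\<Phi> \<subseteq> C\<close>.
\<close>

text \<open>Since \<open>S\<close> is the closure of its interior, a point of \<open>S\<close> outside the closed set \<open>C\<close> would
  bring with it a non-empty open subset of \<open>S - C\<close>.\<close>

lemma negligible_convex_Diff_closed_iff: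
  fixes S C :: "'a::euclidean_space set"
  assumes "closed S" "convex S" "interior S \<noteq> {}" "closed C"
  shows "negligible (S - C) \<longleftrightarrow> S \<subseteq> C"
proof
  assume neg: "negligible (S - C)"
  have "open (interior S - C)"
    using assms(4) by (intro open_Diff) auto
  moreover have "negligible (interior S - C)"
    using neg interior_subset by (rule negligible_subset[OF _ Diff_mono]) auto
  ultimately have "interior S \<subseteq> C"
    using open_not_negligible by blast
  then have "closure (interior S) \<subseteq> C"
    using assms(4) by (rule closure_minimal)
  then show "S \<subseteq> C"
    using convex_closure_interior[OF assms(2,3)] assms(1) by simp
next
  assume "S \<subseteq> C"
  then have "S - C = {}" by blast
  then show "negligible (S - C)" by simp
qed

lemma prob_space_law_of_density:
  assumes "f \<in> prob_densities"
  shows "prob_space (law_of_density f)"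
proof
  have f: "integrable lebesgue f" "integral\<^sup>L lebesgue f = 1" "\<And>t. 0 \<le> f t"
    using assms by (auto simp: prob_densities_def)
  have "(\<integral>\<^sup>+ t. ennreal (f t) \<partial>lebesgue) = 1"
    using f by (simp add: nn_integral_eq_integral)
  then show "emeasure (law_of_density f) (space (law_of_density f)) = 1"
    using f(1) by (simp add: law_of_density_def emeasure_density borel_measurable_integrable)
qed

lemma measure_law_of_density_eq_1_iff:
  assumes f: "f \<in> prob_densities" and "C \<in> sets lebesgue"
  shows "measure (law_of_density f) C = 1 \<longleftrightarrow> (AE t in lebesgue. 0 < f t \<longrightarrow> t \<in> C)"
proof -
  interpret prob_space "law_of_density f"
    using f by (rule prob_space_law_of_density)
  have "f \<in> borel_measurable lebesgue"
    using f by (auto simp: prob_densities_def)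
  then have [measurable]: "(\<lambda>t. ennreal (f t)) \<in> borel_measurable lebesgue"
    by measurable
  have "measure (law_of_density f) C = 1 \<longleftrightarrow> (AE t in law_of_density f. t \<in> C)"
    using assms(2) by (intro prob_eq_1) (simp add: law_of_density_def)
  also have "\<dots> \<longleftrightarrow> (AE t in lebesgue. 0 < f t \<longrightarrow> t \<in> C)"
    unfolding law_of_density_def by (subst AE_density) auto
  finally show ?thesis .
qed

lemma is_support_density_positive_on_convex:
  assumes f: "f \<in> prob_densities" and pos: "\<And>t. 0 < f t \<longleftrightarrow> t \<in> \<Phi>"
    and \<Phi>: "closed \<Phi>" "convex \<Phi>" "interior \<Phi> \<noteq> {}"
  shows "is_support (law_of_density f) \<Phi>"
  unfolding is_support_def
proof (intro conjI allI impI)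
  fix C :: "(real^'a) set" assume C: "closed C"
  have sets: "C \<in> sets lebesgue" "\<Phi> - C \<in> sets lebesgue"
    using C \<Phi>(1) by (auto intro: borel_closed)
  have "measure (law_of_density f) C = 1 \<longleftrightarrow> (AE t in lebesgue. t \<notin> \<Phi> - C)"
    using measure_law_of_density_eq_1_iff[OF f sets(1)] by (simp add: pos)
  also have "\<dots> \<longleftrightarrow> negligible (\<Phi> - C)"
    using AE_iff_null_sets[OF sets(2)] by (simp add: negligible_iff_null_sets)
  also have "\<dots> \<longleftrightarrow> \<Phi> \<subseteq> C"
    using \<Phi> C by (rule negligible_convex_Diff_closed_iff)
  finally show "measure (law_of_density f) C = 1 \<longleftrightarrow> \<Phi> \<subseteq> C" .
qed (rule \<Phi>(1))

text \<open>By \<open>\<sigma>\<close>-finiteness there is an integrable function with values in \<open>(0, 1]\<close>. Restricted to \<open>S\<close>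
  it has positive mass and can be normalized; raising its value at the single point \<open>p\<close> to the
  bound \<open>1\<close> puts a global maximum there and leaves the integral unchanged.\<close>

lemma exists_density_positive_on_peaked_at:
  fixes S :: "(real^'m) set"
  assumes S: "S \<in> sets lebesgue" "\<not> negligible S" and p: "p \<in> S"
  obtains f where "f \<in> prob_densities" "\<And>t. 0 < f t \<longleftrightarrow> t \<in> S" "\<And>t. f t \<le> f p"
proof -
  obtain h :: "real^'m \<Rightarrow> real" where h: "h \<in> borel_measurable lborel"
    "\<And>t. 0 < h t" "\<And>t. h t \<le> 1" "integrable lborel h"
    using sigma_finite_measure.obtain_positive_integrable_function[OF sigma_finite_lborel]
    by metis
  define g where "g = (\<lambda>t. indicator S t * (if t = p then 1 else h t))"
  have g_pos_iff: "0 < g t \<longleftrightarrow> t \<in> S" and g_nonneg: "0 \<le> g t" and g_le: "g t \<le> g p" for t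
    using h(2,3)[of t] p by (auto simp: g_def indicator_def)
  have "integrable lborel (\<lambda>t. h t + (1 - h p) * indicator {p} t)"
    using h(4) by simp
  then have "integrable lborel (\<lambda>t. if t = p then 1 else h t)"
    by (rule back_subst[where P = "integrable lborel"]) (auto simp: indicator_def)
  then have "integrable lebesgue (\<lambda>t. if t = p then 1 else h t)"
    by (simp add: integrable_completion)
  then have g_int: "integrable lebesgue g"
    unfolding g_def using S(1) integrable_mult_indicator[of S lebesgue "\<lambda>t. if t = p then 1 else h t"]
    by simp
  define I where "I = integral\<^sup>L lebesgue g"
  have "I \<noteq> 0"
  proof
    assume "I = 0"
    then have "AE t in lebesgue. g t = 0"
      using g_int g_nonneg by (simp add: I_def integral_nonneg_eq_0_iff_AE)
    then have "AE t in lebesgue. t \<notin> S"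
      by eventually_elim (metis g_pos_iff less_irrefl)
    then show False
      using S by (simp add: AE_iff_null_sets[symmetric] negligible_iff_null_sets)
  qed
  moreover have "0 \<le> I"
    unfolding I_def using g_nonneg by (intro integral_nonneg_AE) simp
  ultimately have I: "0 < I" by simp
  show thesis
  proof
    show "(\<lambda>t. g t / I) \<in> prob_densities"
      using g_int g_nonneg I by (simp add: prob_densities_def I_def[symmetric])
    show "0 < g t / I \<longleftrightarrow> t \<in> S" for t
      using I g_pos_iff by (simp add: zero_less_divide_iff)
    show "g t / I \<le> g p / I" for t
      using I g_le by (simp add: divide_right_mono)
  qed
qed

lemma solution_set_eq:
  "solution_set \<Phi> R y = {x \<in> feasible \<Phi> R. y - theta R x \<in> \<Phi>}"
  by (auto simp: solution_set_def feasible_def)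

lemma admissible_densities_eq:
  "admissible_densities \<Phi> R y =
     {f \<in> prob_densities. (\<forall>\<delta>. \<delta> \<notin> \<Phi> \<longrightarrow> f \<delta> = 0) \<and> is_support (law_of_density f) \<Phi> \<and>
        (\<exists>x \<in> feasible \<Phi> R. f (y - theta R x) > 0)}"
  by (auto simp: admissible_densities_def feasible_def)

lemma ml_estimates_subset_solution_set:
  assumes f: "f \<in> admissible_densities \<Phi> R y"
  shows "ml_estimates \<Phi> R y f \<subseteq> solution_set \<Phi> R y"
proof
  fix x assume "x \<in> ml_estimates \<Phi> R y f"
  then have x: "x \<in> feasible \<Phi> R"
    and max: "\<And>z. z \<in> feasible \<Phi> R \<Longrightarrow> f (y - theta R z) \<le> f (y - theta R x)"
    by (auto simp: ml_estimates_def is_arg_max_linorder)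
  obtain z where "z \<in> feasible \<Phi> R" "0 < f (y - theta R z)"
    using f by (auto simp: admissible_densities_eq)
  with max have "f (y - theta R x) \<noteq> 0"
    by force
  with f x show "x \<in> solution_set \<Phi> R y"
    by (auto simp: admissible_densities_eq solution_set_eq)
qed

lemma solution_is_ml_estimate:
  assumes \<Phi>: "closed \<Phi>" "convex \<Phi>" "interior \<Phi> \<noteq> {}"
    and x: "x \<in> solution_set \<Phi> R y"
  obtains f where "f \<in> admissible_densities \<Phi> R y" "x \<in> ml_estimates \<Phi> R y f"
proof -
  have x': "x \<in> feasible \<Phi> R" "y - theta R x \<in> \<Phi>"
    using x by (auto simp: solution_set_eq)
  have "\<Phi> \<in> sets lebesgue"
    using \<Phi>(1) by (auto intro: borel_closed)
  moreover have "\<not> negligible \<Phi>"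
    using negligible_convex_Diff_closed_iff[OF \<Phi> closed_empty] x'(2) by auto
  ultimately obtain f where f: "f \<in> prob_densities" "\<And>t. 0 < f t \<longleftrightarrow> t \<in> \<Phi>"
      "\<And>t. f t \<le> f (y - theta R x)"
    using x'(2) exists_density_positive_on_peaked_at[of \<Phi> "y - theta R x"] by blast
  have "f \<delta> = 0" if "\<delta> \<notin> \<Phi>" for \<delta>
    using f(1) f(2)[of \<delta>] that by (force simp: prob_densities_def not_less intro: antisym)
  moreover have "is_support (law_of_density f) \<Phi>"
    using f(1,2) \<Phi> by (rule is_support_density_positive_on_convex)
  ultimately have "f \<in> admissible_densities \<Phi> R y"
    using f(1,2) x' by (auto simp: admissible_densities_eq)
  moreover have "x \<in> ml_estimates \<Phi> R y f"
    using f(3) x'(1) by (simp add: ml_estimates_def is_arg_max_linorder)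
  ultimately show thesis by (rule that)
qed

theorem theorem1:
  fixes R :: "(real^'d)^'m" and y :: "real^'m" and \<Phi> :: "(real^'m) set"
  assumes "closed \<Phi>" and "convex \<Phi>" and "interior \<Phi> \<noteq> {}"
    and "solution_set \<Phi> R y \<noteq> {}"
  shows "(\<Union>f \<in> admissible_densities \<Phi> R y. ml_estimates \<Phi> R y f) = solution_set \<Phi> R y"
proof
  show "(\<Union>f \<in> admissible_densities \<Phi> R y. ml_estimates \<Phi> R y f) \<subseteq> solution_set \<Phi> R y"
    by (intro UN_least ml_estimates_subset_solution_set)
  show "solution_set \<Phi> R y \<subseteq> (\<Union>f \<in> admissible_densities \<Phi> R y. ml_estimates \<Phi> R y f)"
    using solution_is_ml_estimate[OF assms(1-3)] by blast
qed

end
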